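(* For every constant $c \in (0,1/2]$ there exist a positive integer $\ell$ bounded by a polynomial in $1/c$, and a constant $C_c>0$, such that for all sufficiently large $n$, $$\mathrm{ORS}_n(cn) \le C_c \cdot \frac{n}{\log^{(\ell)} n},$$ where $\log^{(\ell)}$ denotes the $\ell$-fold iterated logarithm.
   Context: For a matching $M$, $V(M)$ denotes the set of vertices matched by $M$. A sequence $M_1,\dots,M_t$ of pairwise edge-disjoint matchings is called ordered-induced if for every $i\in[t]$, $M_i$ is an induced matching of the graph with edge set $M_1\cup\dots\cup M_i$, i.e., no edge of $M_1\cup\cdots\cup M_{i-1}$ has both endpoints in $V(M_i)$. An $n$-vertex graph is an $\mathrm{ORS}_n(r,t)$ graph if its edge set is the union of an ordered-induced sequence of $t$ matchings, each of size exactly $r$. $\mathrm{ORS}_n(r)$ denotes the maximum $t$ for which an $\mathrm{ORS}_n(r,t)$ graph exists (for non-integer $r$, $r$ is replaced by $\lceil r\rceil$). *)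

theory Defs
  imports Complex_Main
begin

definition is_matching :: "nat \<Rightarrow> nat set set \<Rightarrow> bool" where
  "is_matching n M \<longleftrightarrow>
     (\<forall>e\<in>M. \<exists>u v. u \<noteq> v \<and> u < n \<and> v < n \<and> e = {u, v}) \<and>
     (\<forall>e\<in>M. \<forall>f\<in>M. e \<noteq> f \<longrightarrow> e \<inter> f = {})"

definition matched_vertices :: "nat set set \<Rightarrow> nat set" where
  "matched_vertices M = \<Union>M"

text \<open>An ORS_n(r,t) graph: union of an ordered-induced sequence of t pairwise
  edge-disjoint matchings M_0,...,M_{t-1}, each of size exactly r.\<close>
definition ORS_graph :: "nat \<Rightarrow> nat \<Rightarrow> nat \<Rightarrow> bool" where
  "ORS_graph n r t \<longleftrightarrow>
     (\<exists>Ms :: nat \<Rightarrow> nat set set.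
        (\<forall>i<t. is_matching n (Ms i) \<and> card (Ms i) = r) \<and>
        (\<forall>i<t. \<forall>j<t. i \<noteq> j \<longrightarrow> Ms i \<inter> Ms j = {}) \<and>
        (\<forall>i<t. \<forall>j<i. \<forall>e\<in>Ms j. \<not> e \<subseteq> matched_vertices (Ms i)))"

definition ORS :: "nat \<Rightarrow> nat \<Rightarrow> nat" where
  "ORS n r = Sup {t. ORS_graph n r t}"

definition ORS_real :: "nat \<Rightarrow> real \<Rightarrow> nat" where
  "ORS_real n x = ORS n (nat \<lceil>x\<rceil>)"

definition iter_log :: "nat \<Rightarrow> real \<Rightarrow> real" where
  "iter_log l x = ((\<lambda>y. log 2 y) ^^ l) x"

end

theory Submission
  imports Defs "HOL-Library.FuncSet" "HOL-Real_Asymp.Real_Asymp"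
begin

text \<open>
  Density increment. Let \<open>G\<close> be the union of the earlier half of the matchings, and call a vertex
  heavy if its degree in \<open>G\<close> is at least \<open>c\<close> times the number of these matchings; at least \<open>c n\<close>
  vertices are heavy. If many later matchings mostly avoid the heavy vertices, deleting the heavy
  vertices increases the relative size of these matchings. Otherwise many later matchings \<open>M\<close> cover
  many heavy vertices, so \<open>V(M)\<close> has \<open>\<Omega>(c\<^sup>3 n)\<close> neighbours in \<open>G\<close>, none of which lies in \<open>V(M)\<close>.
  If there are \<open>n / d\<close> matchings, a greedily chosen set \<open>S\<close> of \<open>O(d / c\<^sup>3)\<close>
  vertices has the property that \<open>S \<inter> V(M)\<close> already has that many neighbours, up to a constant, for
  many \<open>M\<close>. By pigeonhole a \<open>2^(-O(d/c\<^sup>3))\<close> fraction of the matchings shares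
  the set \<open>S \<inter> V(M)\<close>, and all of them avoid its neighbourhood, which can be deleted.

  Either way the ratio \<open>c\<close> grows by \<open>c\<^sup>4 / 32\<close> while the number of matchings drops by a factor
  \<open>2^O(d/c\<^sup>3)\<close>. As the ratio never exceeds \<open>1/2\<close>, this can be repeated at most
  \<open>16 / c\<^sup>4\<close> times, each round costing one exponential.
\<close>

section \<open>Averaging, greedy covering and initial segments of finite index sets\<close>

text \<open>A reverse Markov inequality: the elements below \<alpha> account for at most
  \<open>card X * \<alpha>\<close> of the sum, so the remaining \<open>B * y\<close> must come from
  elements contributing at most \<open>B\<close> each.\<close>

lemma card_ge_threshold:
  fixes f :: "'a \<Rightarrow> real"
  assumes fin: "finite X" and "0 < B" "0 \<le> \<alpha>"
    and le: "\<And>x. x \<in> X \<Longrightarrow> f x \<le> B"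
    and ge: "real (card X) * \<alpha> + B * y \<le> (\<Sum>x\<in>X. f x)"
  shows "y \<le> card {x \<in> X. \<alpha> \<le> f x}"
proof -
  let ?H = "{x \<in> X. \<alpha> \<le> f x}"
  have "(\<Sum>x\<in>X. f x) \<le> (\<Sum>x\<in>X. \<alpha> + (if x \<in> ?H then B else 0))"
    using le \<open>0 \<le> \<alpha>\<close> by (intro sum_mono) (auto simp: add_increasing)
  also have "\<dots> = real (card X) * \<alpha> + B * card ?H"
    using fin by (simp add: sum.distrib sum.If_cases Int_def mult.commute)
  finally have "B * y \<le> B * card ?H" using ge by linarith
  then show ?thesis using \<open>0 < B\<close> by simp
qed

text \<open>By double counting, some vertex hits at least a fraction \<open>b / card V\<close> of
  the elements of \<open>X\<close> not hit so far. Adding it to \<open>S\<close> shrinks the unhit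
  part by a factor of at most \<open>1 - b / card V\<close>, hence of at most
  \<open>exp (- b / card V)\<close>.\<close>

lemma greedy_cover:
  fixes b :: real
  assumes V: "finite V" "V \<noteq> {}" and X: "finite X"
    and b: "\<And>x. x \<in> X \<Longrightarrow> b \<le> card {v \<in> V. R v x}"
  shows "\<exists>S\<subseteq>V. card S \<le> k \<and>
    card {x \<in> X. \<forall>v\<in>S. \<not> R v x} \<le> exp (- b * k / card V) * card X"
proof (induction k)
  case 0
  show ?case by (intro exI[of _ "{}"]) auto
next
  case (Suc k)
  then obtain S where S: "S \<subseteq> V" "card S \<le> k"
    and le: "card {x \<in> X. \<forall>v\<in>S. \<not> R v x} \<le> exp (- b * k / card V) * card X" by blast
  define Y where "Y = {x \<in> X. \<forall>v\<in>S. \<not> R v x}"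
  have Y: "finite Y" "Y \<subseteq> X" using X by (auto simp: Y_def)
  have n: "0 < real (card V)" using V by (simp add: card_gt_0_iff)
  have "\<exists>v\<in>V. b * card Y / card V \<le> card {x \<in> Y. R v x}"
  proof (rule ccontr)
    assume "\<not> ?thesis"
    then have "(\<Sum>v\<in>V. real (card {x \<in> Y. R v x})) < (\<Sum>v\<in>V. b * card Y / card V)"
      using V by (intro sum_strict_mono) auto
    also have "\<dots> = b * card Y" using n by simp
    also have "\<dots> = (\<Sum>x\<in>Y. b)" by simp
    also have "\<dots> \<le> (\<Sum>x\<in>Y. real (card {v \<in> V. R v x}))"
      using b Y by (intro sum_mono) auto
    also have "\<dots> = (\<Sum>v\<in>V. real (card {x \<in> Y. R v x}))"
      using sum_multicount_gen[OF V(1) Y(1), of R "\<lambda>x. card {v \<in> V. R v x}"]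
      by (simp flip: of_nat_sum)
    finally show False by simp
  qed
  then obtain v where v: "v \<in> V" "b * card Y / card V \<le> card {x \<in> Y. R v x}" by blast
  have "card {x \<in> Y. \<not> R v x} + card {x \<in> Y. R v x} = card Y"
    using Y(1) by (subst card_Un_disjoint[symmetric]) (auto intro: arg_cong[where f = card])
  then have "card {x \<in> Y. \<not> R v x} = card Y - real (card {x \<in> Y. R v x})" by linarith
  also have "\<dots> \<le> (1 + - b / card V) * card Y" using v(2) by (simp add: algebra_simps)
  also have "\<dots> \<le> exp (- b / card V) * card Y"
    by (intro mult_right_mono exp_ge_add_one_self) auto
  also have "\<dots> \<le> exp (- b / card V) * (exp (- b * k / card V) * card X)"
    using le by (intro mult_left_mono) (auto simp: Y_def)
  also have "\<dots> = exp (- b * Suc k / card V) * card X"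
    by (simp add: mult.assoc[symmetric] exp_add[symmetric]) (simp add: add_divide_distrib[symmetric] algebra_simps)
  finally have "card {x \<in> Y. \<not> R v x} \<le> exp (- b * Suc k / card V) * card X" .
  moreover have "{x \<in> Y. \<not> R v x} = {x \<in> X. \<forall>w\<in>insert v S. \<not> R w x}" by (auto simp: Y_def)
  moreover have "card (insert v S) \<le> Suc k"
    using S finite_subset[OF S(1) V(1)] by (simp add: card_insert_if)
  ultimately show ?case using S v(1) by (intro exI[of _ "insert v S"]) auto
qed

lemma initial_segment_exists:
  fixes I :: "'i::linorder set"
  assumes "finite I" "k \<le> card I"
  shows "\<exists>J\<subseteq>I. card J = k \<and> (\<forall>j\<in>J. \<forall>i\<in>I - J. j < i)"
  using assms(2)
proof (induction k)
  case 0
  then show ?case by (intro exI[of _ "{}"]) auto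
next
  case (Suc k)
  then obtain J where J: "J \<subseteq> I" "card J = k" "\<forall>j\<in>J. \<forall>i\<in>I - J. j < i" by auto
  have fin: "finite (I - J)" using assms by simp
  have ne: "I - J \<noteq> {}" using J Suc.prems by auto
  define m where "m = Min (I - J)"
  have m: "m \<in> I - J" using Min_in[OF fin ne] by (simp add: m_def)
  have "m < i" if "i \<in> I - insert m J" for i
    using that Min_le[OF fin, of i] by (auto simp: m_def[symmetric])
  then have "\<forall>j\<in>insert m J. \<forall>i\<in>I - insert m J. j < i" using J(3) by simp
  moreover have "card (insert m J) = Suc k"
    using m J(2) finite_subset[OF J(1) assms(1)] by simp
  moreover have "insert m J \<subseteq> I" using J(1) m by simp
  ultimately show ?case by (intro exI[of _ "insert m J"] conjI)
qed

section \<open>Ordered-induced families of matchings and degrees in their unions\<close>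

text \<open>Edge-disjointness is implied by the last clause: an edge of \<open>M i\<close> lies inside \<open>\<Union>(M i)\<close>.\<close>

definition ordered_induced :: "'a set \<Rightarrow> 'i::linorder set \<Rightarrow> ('i \<Rightarrow> 'a set set) \<Rightarrow> bool" where
  "ordered_induced V I M \<longleftrightarrow> finite V \<and> finite I \<and>
     (\<forall>i\<in>I. (\<forall>e\<in>M i. e \<subseteq> V \<and> card e = 2) \<and> pairwise disjnt (M i)) \<and>
     (\<forall>i\<in>I. \<forall>j\<in>I. j < i \<longrightarrow> (\<forall>e\<in>M j. \<not> e \<subseteq> \<Union>(M i)))"

definition nbrs :: "('i \<Rightarrow> 'a set set) \<Rightarrow> 'i set \<Rightarrow> 'a \<Rightarrow> 'a set" where
  "nbrs M J v = {u. \<exists>j\<in>J. {u, v} \<in> M j}"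

lemma nbrs_sym: "u \<in> nbrs M J v \<longleftrightarrow> v \<in> nbrs M J u"
  by (simp add: nbrs_def insert_commute)

lemma ordered_inducedD:
  assumes "ordered_induced V I M"
  shows "finite V" "finite I"
    "\<And>i e. i \<in> I \<Longrightarrow> e \<in> M i \<Longrightarrow> e \<subseteq> V"
    "\<And>i e. i \<in> I \<Longrightarrow> e \<in> M i \<Longrightarrow> card e = 2"
    "\<And>i. i \<in> I \<Longrightarrow> pairwise disjnt (M i)"
    "\<And>i j e. i \<in> I \<Longrightarrow> j \<in> I \<Longrightarrow> j < i \<Longrightarrow> e \<in> M j \<Longrightarrow> \<not> e \<subseteq> \<Union>(M i)"
  using assms unfolding ordered_induced_def by simp_all

text \<open>Both cases of the density increment pass to such a subfamily. Shrinking the matchings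
  preserves the induced condition because their vertex sets shrink as well.\<close>

lemma ordered_induced_subset:
  assumes oi: "ordered_induced V I M" and J: "J \<subseteq> I" and V': "V' \<subseteq> V"
    and M': "\<And>i. i \<in> J \<Longrightarrow> M' i \<subseteq> M i"
    and e: "\<And>i e. i \<in> J \<Longrightarrow> e \<in> M' i \<Longrightarrow> e \<subseteq> V'"
  shows "ordered_induced V' J M'"
  unfolding ordered_induced_def
proof (intro conjI ballI impI)
  note D = ordered_inducedD[OF oi]
  show "finite V'" "finite J"
    using D(1,2) J V' finite_subset by auto
  show "e \<subseteq> V'" if "i \<in> J" "e \<in> M' i" for i e by (rule e[OF that])
  show "card e = 2" if "i \<in> J" "e \<in> M' i" for i e
    using D(4)[of i e] that J M'[of i] by auto
  show "pairwise disjnt (M' i)" if "i \<in> J" for i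
    using D(5)[of i] that J M'[of i] by (auto intro: pairwise_subset)
  show "\<not> e \<subseteq> \<Union>(M' i)" if "i \<in> J" "j \<in> J" "j < i" "e \<in> M' j" for i j e
  proof -
    have "\<not> e \<subseteq> \<Union>(M i)" using D(6)[of i j e] that J M'[of j] by auto
    moreover have "\<Union>(M' i) \<subseteq> \<Union>(M i)" using M'[OF that(1)] by auto
    ultimately show ?thesis by auto
  qed
qed

lemma card_Union_matching:
  assumes "ordered_induced V I M" "i \<in> I"
  shows "finite (M i)" "card (\<Union>(M i)) = 2 * card (M i)" "\<Union>(M i) \<subseteq> V"
proof -
  have M: "\<And>e. e \<in> M i \<Longrightarrow> e \<subseteq> V \<and> card e = 2" "pairwise disjnt (M i)" "finite V"
    using assms unfolding ordered_induced_def by auto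
  show "\<Union>(M i) \<subseteq> V" using M by blast
  show "finite (M i)" using M by (meson Pow_iff finite_Pow_iff finite_subset subsetI)
  have "card (\<Union>(M i)) = sum card (M i)"
    using M by (intro card_Union_disjoint) (auto intro: finite_subset)
  then show "card (\<Union>(M i)) = 2 * card (M i)" using M by simp
qed

lemma card_nbrs_matching:
  assumes "ordered_induced V I M" "j \<in> I"
  shows "card {u. {u, v} \<in> M j} = (if v \<in> \<Union>(M j) then 1 else 0)"
proof (cases "v \<in> \<Union>(M j)")
  case True
  then obtain e where e: "e \<in> M j" "v \<in> e" by blast
  have M: "card e = 2" "pairwise disjnt (M j)"
    using assms e unfolding ordered_induced_def by auto
  obtain u where u: "e = {u, v}" "u \<noteq> v"
    using M(1) e(2) by (auto simp: card_2_iff doubleton_eq_iff)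
  have "w = u" if "{w, v} \<in> M j" for w
  proof -
    have "{w, v} = e" using pairwiseD[OF M(2) that e(1)] e(2) by (auto simp: disjnt_iff)
    then show ?thesis using u by (auto simp: doubleton_eq_iff)
  qed
  moreover have "{u, v} \<in> M j" using e(1) u(1) by simp
  ultimately have "{u. {u, v} \<in> M j} = {u}" by blast
  then show ?thesis using True by simp
next
  case False
  then have "{u. {u, v} \<in> M j} = {}" by blast
  then show ?thesis using False by simp
qed

text \<open>Each matching covering \<open>v\<close> contributes exactly one neighbour, and different
  matchings contribute different ones, since a common edge would lie inside the vertex set of the
  later matching.\<close>

lemma card_nbrs:
  assumes oi: "ordered_induced V I M" and J: "J \<subseteq> I"
  shows "card (nbrs M J v) = card {j \<in> J. v \<in> \<Union>(M j)}"
proof -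
  have fin: "finite J" "finite V" using assms finite_subset unfolding ordered_induced_def by auto
  have "nbrs M J v = (\<Union>j\<in>J. {u. {u, v} \<in> M j})" by (auto simp: nbrs_def)
  moreover have "card (\<Union>j\<in>J. {u. {u, v} \<in> M j}) = (\<Sum>j\<in>J. card {u. {u, v} \<in> M j})"
  proof (rule card_UN_disjoint[OF fin(1)]; intro ballI impI)
    fix j assume "j \<in> J"
    then have "{u. {u, v} \<in> M j} \<subseteq> V" using oi J unfolding ordered_induced_def by blast
    then show "finite {u. {u, v} \<in> M j}" using fin(2) finite_subset by blast
  next
    fix i j assume ij: "i \<in> J" "j \<in> J" "i \<noteq> j"
    have "M i \<inter> M j = {}"
    proof (cases i j rule: linorder_cases)
      case less
      then have "\<forall>e\<in>M i. \<not> e \<subseteq> \<Union>(M j)" using ij J oi unfolding ordered_induced_def by blast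
      then show ?thesis by blast
    next
      case greater
      then have "\<forall>e\<in>M j. \<not> e \<subseteq> \<Union>(M i)" using ij J oi unfolding ordered_induced_def by blast
      then show ?thesis by blast
    qed (use ij in auto)
    then show "{u. {u, v} \<in> M i} \<inter> {u. {u, v} \<in> M j} = {}" by blast
  qed
  moreover have "(\<Sum>j\<in>J. card {u. {u, v} \<in> M j}) = (\<Sum>j\<in>J. if v \<in> \<Union>(M j) then 1 else 0)"
    using card_nbrs_matching[OF oi] J by (intro sum.cong refl) (simp only: subset_iff)
  moreover have "\<dots> = card {j \<in> J. v \<in> \<Union>(M j)}"
    using fin(1) by (simp add: sum.If_cases Int_def del: Union_iff)
  ultimately show ?thesis by simp
qed

text \<open>The handshake identity, by double counting pairs of a matching and a vertex it
  covers.\<close>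

lemma sum_card_nbrs:
  assumes oi: "ordered_induced V I M" and J: "J \<subseteq> I"
  shows "(\<Sum>v\<in>V. card (nbrs M J v)) = (\<Sum>j\<in>J. 2 * card (M j))"
proof -
  have fin: "finite J" "finite V" using assms finite_subset unfolding ordered_induced_def by auto
  have "(\<Sum>v\<in>V. card (nbrs M J v)) = (\<Sum>v\<in>V. card {j \<in> J. v \<in> \<Union>(M j)})"
    using card_nbrs[OF assms] by simp
  also have "\<dots> = (\<Sum>j\<in>J. card {v \<in> V. v \<in> \<Union>(M j)})"
    by (rule sum_multicount_gen[OF fin(2,1)]) simp
  also have "\<dots> = (\<Sum>j\<in>J. 2 * card (M j))"
  proof (intro sum.cong refl)
    fix j assume "j \<in> J"
    then have *: "j \<in> I" using J by blast
    have "{v \<in> V. v \<in> \<Union>(M j)} = \<Union>(M j)" using card_Union_matching(3)[OF oi *] by blast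
    then show "card {v \<in> V. v \<in> \<Union>(M j)} = 2 * card (M j)"
      using card_Union_matching(2)[OF oi *] by simp
  qed
  finally show ?thesis .
qed

section \<open>One step of the density increment\<close>

lemma less_two_powr:
  fixes x :: real
  assumes "0 \<le> x"
  shows "x < 2 powr x"
proof -
  define n where "n = nat \<lfloor>x\<rfloor>"
  have n: "real n \<le> x" "x < real n + 1" using assms by (auto simp: n_def)
  have "Suc n \<le> 2 ^ n" by (intro Suc_leI less_exp)
  then have "real (Suc n) \<le> real (2 ^ n)" by (rule of_nat_mono)
  also have "\<dots> = 2 powr n" by (simp add: powr_realpow)
  also have "\<dots> \<le> 2 powr x" using n by simp
  finally show ?thesis using n by simp
qed

text \<open>The ratio is tracked through a common lower bound \<open>q\<close> on the matching
  sizes. In one case \<open>q\<close> drops by \<open>c^2 n / 4\<close> while at least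
  \<open>c n\<close> vertices disappear; in the other \<open>q\<close> is kept and at least
  \<open>c^3 n / 32\<close> vertices disappear.\<close>

lemma density_increment:
  fixes c d q :: real and V :: "'a set" and I :: "'i::linorder set"
  assumes oi: "ordered_induced V I M"
    and size: "\<And>i. i \<in> I \<Longrightarrow> q \<le> card (M i)"
    and c: "0 < c" and dens: "c * card V \<le> q" and q: "0 < q" and two: "2 \<le> card I"
    and d: "1 \<le> d" "card V \<le> d * card I"
  obtains V' :: "'a set" and I' :: "'i set" and M' and q' :: real where "ordered_induced V' I' M'"
    "\<And>i. i \<in> I' \<Longrightarrow> q' \<le> card (M' i)" "0 < q'" "(c + c ^ 4 / 32) * card V' \<le> q'"
    "card V' \<le> card V" "card I \<le> 2 powr (408 * d / c ^ 3) * card I'"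
proof -
  note D = ordered_inducedD[OF oi]
  note matched = card_Union_matching[OF oi]
  define n where "n = real (card V)"
  define s where "s = card I div 2"
  obtain J where J: "J \<subseteq> I" "card J = s" "\<And>i j. j \<in> J \<Longrightarrow> i \<in> I - J \<Longrightarrow> j < i"
    using initial_segment_exists[OF D(2), of s] by (auto simp: s_def)
  define L where "L = I - J"
  have finJ: "finite J" "finite L" using D(2) J(1) finite_subset by (auto simp: L_def)
  \<comment> \<open>The factor 3 in place of 2 absorbs the rounding in \<open>s\<close>; three
    indices attain it.\<close>
  have s: "1 \<le> s" "card I \<le> 3 * s" "s \<le> card L"
    using two J(1,2) finJ(1) by (auto simp: s_def L_def card_Diff_subset)
  obtain i0 where "i0 \<in> I" using two by fastforce
  then have "q \<le> card (M i0)" "card (\<Union>(M i0)) \<le> card V"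
    using size card_mono[OF D(1) matched(3)] by auto
  then have qn: "2 * q \<le> n" using matched(2)[OF \<open>i0 \<in> I\<close>] by (simp add: n_def)
  then have n: "0 < n" using q by simp
  have cn: "c * n \<le> q" using dens by (simp add: n_def)
  have "n * (2 * c) \<le> n * 1" using cn qn by (simp add: algebra_simps)
  then have c_half: "c \<le> 1/2" using n by (simp only: mult_le_cancel_left_pos)
  have nbrs_V: "nbrs M J v \<subseteq> V" for v
    using D(3) J(1) by (auto simp: nbrs_def)
  have deg_le: "card (nbrs M J v) \<le> s" for v
    unfolding card_nbrs[OF oi J(1)] J(2)[symmetric] by (intro card_mono finJ) auto
  \<comment> \<open>The average degree is at least \<open>2 * c * s\<close>. Half of this pays for
    the threshold \<open>c * s\<close>; as degrees are at most \<open>s\<close>, the other half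
    yields \<open>c * n\<close> heavy vertices.\<close>
  define W where "W = {v \<in> V. c * s \<le> card (nbrs M J v)}"
  have W: "W \<subseteq> V" by (auto simp: W_def)
  have W_large: "c * n \<le> card W"
    unfolding W_def
  proof (rule card_ge_threshold[where B = s])
    have "real (card V) * (c * s) + s * (c * n) = (\<Sum>j\<in>J. 2 * (c * n))"
      using J(2) by (simp add: n_def algebra_simps)
    also have "\<dots> \<le> (\<Sum>j\<in>J. 2 * real (card (M j)))"
      using size J(1) cn by (intro sum_mono) force
    also have "\<dots> = (\<Sum>v\<in>V. real (card (nbrs M J v)))"
      using arg_cong[OF sum_card_nbrs[OF oi J(1)], of real] by simp
    finally show "real (card V) * (c * s) + s * (c * n) \<le> (\<Sum>v\<in>V. real (card (nbrs M J v)))" .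
  qed (use D(1) s c deg_le in auto)

  \<comment> \<open>Deleting \<open>W\<close> from a ratio \<open>c\<close> gains about
    \<open>c * (c * n)\<close>, so matchings can afford to lose \<open>c^2 n / 4\<close> edges to
    it. Those that would lose more meet \<open>W\<close> often enough to be treated by the covering
    argument.\<close>
  define A where "A = {i \<in> L. card (\<Union>(M i) \<inter> W) < c\<^sup>2 / 4 * n}"
  define B where "B = {i \<in> L. c\<^sup>2 / 4 * n \<le> card (\<Union>(M i) \<inter> W)}"
  have AB: "finite A" "finite B" "A \<subseteq> I" "B \<subseteq> I" "A \<subseteq> L" "B \<subseteq> L"
    using finJ by (auto simp: A_def B_def L_def)
  have "L = A \<union> B" by (auto simp: A_def B_def)
  then have "card L \<le> card A + card B" by (simp add: card_Un_le)
  then consider "card I \<le> 6 * card A" | "card I \<le> 6 * card B" using s by linarith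
  then show ?thesis
  proof cases
    case 1
    define M' where "M' i = {e \<in> M i. e \<inter> W = {}}" for i
    have "ordered_induced (V - W) A M'"
      by (rule ordered_induced_subset[OF oi AB(3)]) (use D(3) AB(3) in \<open>auto simp: M'_def\<close>)
    moreover have "q - c\<^sup>2 / 4 * n \<le> card (M' i)" if i: "i \<in> A" for i
    proof -
      have iI: "i \<in> I" using i AB by blast
      have fin: "finite (M i)" using matched(1)[OF iI] .
      have finU: "finite (\<Union>(M i) \<inter> W)" using W D(1) finite_subset by blast
      \<comment> \<open>Choosing a heavy vertex in each discarded edge is injective because the
        edges are disjoint, so few edges are discarded.\<close>
      have "\<forall>e\<in>M i - M' i. \<exists>v. v \<in> e \<inter> W" by (auto simp: M'_def)
      then obtain g where g: "\<And>e. e \<in> M i - M' i \<Longrightarrow> g e \<in> e \<inter> W" by metis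
      have "inj_on g (M i - M' i)"
      proof (rule inj_onI)
        fix e f assume "e \<in> M i - M' i" "f \<in> M i - M' i" "g e = g f"
        then show "e = f" using g[of e] g[of f] pairwiseD[OF D(5)[OF iI], of e f]
          by (auto simp: disjnt_iff)
      qed
      moreover have "g ` (M i - M' i) \<subseteq> \<Union>(M i) \<inter> W" using g by fastforce
      ultimately have "card (M i - M' i) \<le> card (\<Union>(M i) \<inter> W)"
        using finU by (rule card_inj_on_le)
      moreover have "card (M i) = card (M' i) + card (M i - M' i)"
        using fin by (subst card_Un_disjoint[symmetric]) (auto simp: M'_def intro: arg_cong[where f = card])
      ultimately show ?thesis using i size[OF iI] by (simp add: A_def)
    qed
    moreover have pos: "0 < q - c\<^sup>2 / 4 * n"
    proof -
      have "c * (c * n) \<le> 1/2 * q" using cn c_half c n by (intro mult_mono) auto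
      then show ?thesis using q by (simp add: power2_eq_square)
    qed
    moreover have "(c + c ^ 4 / 32) * card (V - W) \<le> q - c\<^sup>2 / 4 * n"
    proof -
      have "real (card (V - W)) = n - card W"
        using W D(1) by (simp add: n_def card_Diff_subset finite_subset card_mono of_nat_diff)
      then have "(c + c ^ 4 / 32) * card (V - W) \<le> (c + c ^ 4 / 32) * (n - c * n)"
        using W_large c by (intro mult_left_mono) auto
      also have "\<dots> = ((c + c ^ 4 / 32) * (1 - c)) * n" by (simp add: algebra_simps)
      also have "\<dots> \<le> (c - c\<^sup>2 / 4) * n"
      proof (rule mult_right_mono)
        have "c ^ 4 \<le> c\<^sup>2" using c c_half by (intro power_decreasing) auto
        moreover have "0 \<le> c ^ 5" using c by simp
        moreover have "(c + c ^ 4 / 32) * (1 - c) = c - c\<^sup>2 + c ^ 4 / 32 - c ^ 5 / 32"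
          by (simp add: field_simps power_numeral_reduce)
        moreover have "0 \<le> c\<^sup>2" by simp
        ultimately show "(c + c ^ 4 / 32) * (1 - c) \<le> c - c\<^sup>2 / 4" by argo
      qed (use n in simp)
      also have "\<dots> \<le> q - c\<^sup>2 / 4 * n" using cn by (simp add: algebra_simps)
      finally show ?thesis .
    qed
    moreover have "card (V - W) \<le> card V" using D(1) by (intro card_mono) auto
    moreover have "card I \<le> 2 powr (408 * d / c ^ 3) * card A"
    proof -
      have "c ^ 3 \<le> 1" using c c_half by (intro power_le_one) auto
      then have "6 * c ^ 3 \<le> 408 * d" using d by linarith
      then have "6 \<le> 408 * d / c ^ 3" using c by (simp add: field_simps)
      then have "6 \<le> 2 powr (408 * d / c ^ 3)" using less_two_powr[of "408 * d / c ^ 3"] by simp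
      then have "6 * real (card A) \<le> 2 powr (408 * d / c ^ 3) * card A"
        by (intro mult_right_mono) auto
      then show ?thesis using 1 by linarith
    qed
    ultimately show ?thesis by (rule that)
  next
    case 2
    \<comment> \<open>The at least \<open>c^2 n / 4\<close> heavy vertices of \<open>M i\<close>
      send out at least \<open>c^3 n s / 4\<close> edges. Half pays for the threshold
      \<open>b * s\<close> on the multiplicity of an endpoint \<open>u\<close>, the other half gives
      \<open>b * n\<close> such endpoints.\<close>
    define b where "b = c ^ 3 / 8"
    have b: "0 < b" using c by (simp add: b_def)
    \<comment> \<open>The elements to be hit are pairs \<open>(i, u)\<close>: a vertex
      \<open>v\<close> hits one if it certifies that \<open>u\<close> is a neighbour of the vertex
      set of \<open>M i\<close>. \<open>X\<close> keeps the pairs with many certificates, as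
      \<open>greedy_cover\<close> requires.\<close>
    define R where "R = (\<lambda>v (i, u). v \<in> \<Union>(M i) \<inter> W \<and> u \<in> nbrs M J v)"
    define X where "X = {(i, u). i \<in> B \<and> u \<in> V \<and> b * s \<le> card {v \<in> V. R v (i, u)}}"
    have "X \<subseteq> B \<times> V" by (auto simp: X_def)
    then have finX: "finite X" using AB D(1) finite_subset by blast
    have X_large: "b * n \<le> card {u. (i, u) \<in> X}" if i: "i \<in> B" for i
    proof -
      let ?U = "\<Union>(M i) \<inter> W"
      have U: "?U \<subseteq> V" using W by blast
      have R_eq: "{v \<in> V. R v (i, u)} = {v \<in> ?U. u \<in> nbrs M J v}" for u
        using U by (auto simp: R_def)
      have "b * n \<le> card {u \<in> V. b * s \<le> card {v \<in> V. R v (i, u)}}"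
      proof (rule card_ge_threshold[where B = s])
        fix u
        have "{v \<in> V. R v (i, u)} \<subseteq> nbrs M J u"
          by (auto simp: R_def nbrs_sym[of u])
        then have "card {v \<in> V. R v (i, u)} \<le> card (nbrs M J u)"
          using nbrs_V D(1) by (meson card_mono finite_subset)
        then show "real (card {v \<in> V. R v (i, u)}) \<le> s" using deg_le[of u] by linarith
      next
        have finU: "finite ?U" using U D(1) finite_subset by blast
        have "real (card V) * (b * s) + s * (b * n) = (c\<^sup>2 / 4 * n) * (c * s)"
          by (simp add: b_def n_def power_numeral_reduce)
        also have "\<dots> \<le> card ?U * (c * s)"
          using i c by (intro mult_right_mono) (auto simp: B_def)
        also have "\<dots> = (\<Sum>w\<in>?U. c * s)" by simp
        also have "\<dots> \<le> (\<Sum>w\<in>?U. real (card (nbrs M J w)))"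
          by (intro sum_mono) (auto simp: W_def)
        also have "\<dots> = (\<Sum>w\<in>?U. real (card {u \<in> V. u \<in> nbrs M J w}))"
          using nbrs_V by (intro sum.cong refl arg_cong[where f = "\<lambda>x. real (card x)"]) blast
        also have "\<dots> = (\<Sum>u\<in>V. real (card {v \<in> ?U. u \<in> nbrs M J v}))"
          using sum_multicount_gen[OF finU D(1), of "\<lambda>w u. u \<in> nbrs M J w" "\<lambda>u. card {v \<in> ?U. u \<in> nbrs M J v}"]
          by (simp flip: of_nat_sum)
        finally show "real (card V) * (b * s) + s * (b * n) \<le> (\<Sum>u\<in>V. real (card {v \<in> V. R v (i, u)}))"
          by (simp only: R_eq)
      qed (use D(1) s b in auto)
      also have "{u \<in> V. b * s \<le> card {v \<in> V. R v (i, u)}} = {u. (i, u) \<in> X}"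
        using i by (auto simp: X_def)
      finally show ?thesis .
    qed
    \<comment> \<open>This many choices bring the exponent down to at most -1, so \<open>S\<close>
      misses at most half of \<open>X\<close>.\<close>
    define k where "k = nat \<lceil>n / (b * s)\<rceil>"
    have bs: "0 < b * s" using b s by simp
    have "V \<noteq> {}" using n by (auto simp: n_def)
    moreover have "b * s \<le> card {v \<in> V. R v x}" if "x \<in> X" for x
      using that by (auto simp: X_def)
    ultimately obtain S where S: "S \<subseteq> V" "card S \<le> k"
      "card {x \<in> X. \<forall>v\<in>S. \<not> R v x} \<le> exp (- (b * s) * k / card V) * card X"
      using greedy_cover[OF D(1) _ finX, of "b * s" R k] by auto
    have finS: "finite S" using S(1) D(1) finite_subset by blast
    define N where "N T = (\<Union>v\<in>T. nbrs M J v)" for T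
    have finN: "finite (N T)" "N T \<subseteq> V" for T
    proof -
      show "N T \<subseteq> V" using nbrs_V by (auto simp: N_def)
      then show "finite (N T)" using D(1) finite_subset by blast
    qed
    have covered: "card B * (b * n / 2) \<le> (\<Sum>i\<in>B. real (card (N (S \<inter> \<Union>(M i)))))"
    proof -
      have "n / (b * s) \<le> k" unfolding k_def by linarith
      then have "1 \<le> b * s * k / card V" using bs n by (simp add: field_simps flip: n_def)
      then have "exp (- (b * s) * k / card V) \<le> exp (- 1)" by simp
      also have "\<dots> \<le> (1/2 :: real)"
        using exp_ge_add_one_self[of 1] by (simp add: exp_minus field_simps)
      finally have "exp (- (b * s) * k / card V) * card X \<le> 1/2 * card X"
        by (intro mult_right_mono) auto
      then have un: "card {x \<in> X. \<forall>v\<in>S. \<not> R v x} \<le> card X / 2" using S(3) by linarith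
      have X_Sigma: "X = (SIGMA i:B. {u. (i, u) \<in> X})" by (auto simp: X_def)
      have fin_i: "finite {u. (i, u) \<in> X}" for i
        using D(1) by (rule finite_subset[rotated]) (auto simp: X_def)
      have "card B * (b * n) = (\<Sum>i\<in>B. b * n)" by simp
      also have "\<dots> \<le> (\<Sum>i\<in>B. real (card {u. (i, u) \<in> X}))"
        using X_large by (intro sum_mono) auto
      also have "\<dots> = card X"
        by (subst X_Sigma, subst card_SigmaI) (use AB fin_i in auto)
      finally have big: "card B * (b * n) \<le> card X" .
      \<comment> \<open>A certificate \<open>v\<close> in \<open>S\<close> for \<open>(i, u)\<close>
        lies in the trace of \<open>S\<close> on \<open>M i\<close>, so \<open>u\<close> is a
        neighbour of that trace.\<close>
      have "{x \<in> X. \<exists>v\<in>S. R v x} \<subseteq> (SIGMA i:B. N (S \<inter> \<Union>(M i)))"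
        by (auto simp: X_def R_def N_def)
      then have "card {x \<in> X. \<exists>v\<in>S. R v x} \<le> card (SIGMA i:B. N (S \<inter> \<Union>(M i)))"
        using AB finN by (intro card_mono) auto
      also have "\<dots> = (\<Sum>i\<in>B. card (N (S \<inter> \<Union>(M i))))"
        using AB finN by (intro card_SigmaI) auto
      finally have cov: "card {x \<in> X. \<exists>v\<in>S. R v x} \<le> (\<Sum>i\<in>B. card (N (S \<inter> \<Union>(M i))))" .
      have "card X = card {x \<in> X. \<exists>v\<in>S. R v x} + card {x \<in> X. \<forall>v\<in>S. \<not> R v x}"
        using finX by (subst card_Un_disjoint[symmetric]) (auto intro: arg_cong[where f = card])
      then have "card X / 2 \<le> card {x \<in> X. \<exists>v\<in>S. R v x}" using un by simp
      also have "\<dots> \<le> (\<Sum>i\<in>B. real (card (N (S \<inter> \<Union>(M i)))))"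
        using cov by (simp flip: of_nat_sum)
      finally show ?thesis using big by linarith
    qed
    define C where "C = {i \<in> B. b * n / 4 \<le> card (N (S \<inter> \<Union>(M i)))}"
    have C_large: "card B * (b / 4) \<le> card C"
      unfolding C_def
    proof (rule card_ge_threshold[where B = n])
      show "card B * (b * n / 4) + n * (card B * (b / 4)) \<le> (\<Sum>i\<in>B. real (card (N (S \<inter> \<Union>(M i)))))"
        using covered by (simp add: algebra_simps)
      show "real (card (N (S \<inter> \<Union>(M i)))) \<le> n" for i
        using card_mono[OF D(1) finN(2)] by (simp add: n_def)
    qed (use AB n b in auto)
    \<comment> \<open>Pigeonhole over the possible traces on \<open>S\<close>, of which there are
      \<open>2 ^ card S\<close>.\<close>
    have "\<exists>T\<in>Pow S. card C \<le> card ((\<lambda>i. S \<inter> \<Union>(M i)) -` {T} \<inter> C) * card (Pow S)"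
      by (rule pigeonhole_card) (use finS AB in \<open>auto simp: C_def\<close>)
    then obtain T where T: "card C \<le> card ((\<lambda>i. S \<inter> \<Union>(M i)) -` {T} \<inter> C) * card (Pow S)" by blast
    define I' where "I' = (\<lambda>i. S \<inter> \<Union>(M i)) -` {T} \<inter> C"
    have I': "I' \<subseteq> C" "I' \<subseteq> L" "I' \<subseteq> I" using AB by (auto simp: I'_def C_def)
    have "0 < real (card I)" using two by simp
    then have "0 < real (card B)" using 2 by linarith
    then have "0 < real (card C)" using C_large b mult_pos_pos[of "real (card B)" "b / 4"] by linarith
    then have "0 < card I'" using T by (auto simp: I'_def intro!: Nat.gr0I)
    then obtain i1 where i1: "i1 \<in> I'" by (auto simp: card_gt_0_iff)
    have N_large: "b * n / 4 \<le> card (N T)" using i1 by (auto simp: I'_def C_def)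
    \<comment> \<open>The matchings survive intact: a vertex \<open>u\<close> of \<open>M i\<close>
      in \<open>N T\<close> would be joined by an edge of an earlier matching to some
      \<open>v\<close> in \<open>T\<close>, which is also covered by \<open>M i\<close>, against the
      induced condition.\<close>
    have "ordered_induced (V - N T) I' M"
    proof (rule ordered_induced_subset[OF oi I'(3)])
      fix i e assume i: "i \<in> I'" and e: "e \<in> M i"
      have iL: "i \<in> I - J" using i I'(2) by (auto simp: L_def)
      have "u \<notin> N T" if "u \<in> e" for u
      proof
        assume "u \<in> N T"
        then obtain v j where v: "v \<in> T" "j \<in> J" "{u, v} \<in> M j" by (auto simp: N_def nbrs_def)
        have "v \<in> \<Union>(M i)" using v(1) i by (auto simp: I'_def)
        moreover have "u \<in> \<Union>(M i)" using \<open>u \<in> e\<close> e by blast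
        moreover have "\<not> {u, v} \<subseteq> \<Union>(M i)"
          using D(6)[of i j "{u, v}"] J(1) J(3)[OF v(2) iL] iL v by auto
        ultimately show False by blast
      qed
      moreover have "e \<subseteq> V" using D(3)[of i e] iL e by blast
      ultimately show "e \<subseteq> V - N T" by blast
    qed auto
    moreover have "q \<le> card (M i)" if "i \<in> I'" for i using size I'(3) that by blast
    moreover have "(c + c ^ 4 / 32) * card (V - N T) \<le> q"
    proof -
      have "real (card (V - N T)) = n - card (N T)"
        using finN D(1) by (simp add: n_def card_Diff_subset card_mono of_nat_diff)
      then have "(c + c ^ 4 / 32) * card (V - N T) \<le> (c + c ^ 4 / 32) * (n - b * n / 4)"
        using N_large c by (intro mult_left_mono) auto
      \<comment> \<open>The increment is chosen so that
        \<open>c + c^4 / 32 = c * (1 + b / 4)\<close>, making this a difference of squares.\<close>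
      also have "\<dots> = c * n * (1 - (b / 4)\<^sup>2)"
        by (simp add: b_def algebra_simps power_numeral_reduce)
      also have "\<dots> \<le> c * n" using c n by (simp add: mult_le_cancel_left1)
      finally show ?thesis using cn by linarith
    qed
    moreover have "card (V - N T) \<le> card V" using D(1) by (intro card_mono) auto
    moreover have "card I \<le> 2 powr (408 * d / c ^ 3) * card I'"
    proof -
      \<comment> \<open>The losses are 6 for passing to \<open>B\<close>, \<open>4 / b\<close> for
        \<open>C\<close> and \<open>2 ^ card S\<close> for the trace. They multiply to at most
        \<open>2 powr (216 * y + 1)\<close>, which is within the stated bound as
        \<open>1 \<le> y\<close>.\<close>
      define y where "y = d / c ^ 3"
      have "c ^ 3 \<le> 1" using c c_half by (intro power_le_one) auto
      then have y: "1 / c ^ 3 \<le> y" "1 \<le> y" using c d by (auto simp: y_def field_simps)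
      have ns: "n \<le> 3 * d * s"
      proof -
        have "d * real (card I) \<le> d * (3 * real s)" using s(2) d(1) by (intro mult_left_mono) auto
        then show ?thesis using d(2) by (simp add: n_def)
      qed
      have "n / (b * s) \<le> (3 * d * s) / (b * s)" using ns bs by (intro divide_right_mono) auto
      also have "\<dots> = 24 * y" using s(1) by (simp add: b_def y_def)
      finally have "real k \<le> 24 * y + 1" unfolding k_def using y by linarith
      then have "real (card S) \<le> 24 * y + 1" using S(2) by linarith
      then have "(2::real) ^ card S \<le> 2 powr (24 * y + 1)" by (simp flip: powr_realpow)
      then have Pow: "real (card (Pow S)) \<le> 2 powr (24 * y + 1)" using finS by (simp add: card_Pow)
      have "card B * (b / 4) \<le> real (card I') * card (Pow S)"
        using C_large T unfolding I'_def by (metis (no_types, lifting) of_nat_le_iff of_nat_mult order_trans)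
      also have "\<dots> \<le> real (card I') * 2 powr (24 * y + 1)"
        using Pow by (intro mult_left_mono) auto
      finally have "card B \<le> (4 / b) * (2 powr (24 * y + 1) * card I')"
        using b by (simp add: field_simps)
      then have "card I \<le> (24 / b) * (2 powr (24 * y + 1) * card I')" using 2 by linarith
      also have "24 / b = 192 * (1 / c ^ 3)" by (simp add: b_def)
      also have "192 * (1 / c ^ 3) * (2 powr (24 * y + 1) * card I')
          \<le> 2 powr (192 * y) * (2 powr (24 * y + 1) * card I')"
        using y less_two_powr[of "192 * y"] by (intro mult_right_mono) auto
      also have "\<dots> = 2 powr (216 * y + 1) * card I'" by (simp flip: mult.assoc powr_add)
      also have "\<dots> \<le> 2 powr (408 * d / c ^ 3) * card I'"
        using y by (intro mult_right_mono) (auto simp: y_def)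
      finally show ?thesis .
    qed
    ultimately show ?thesis using q by (intro that[of "V - N T" I' M q])
  qed
qed

section \<open>Iterated exponentials and the iteration of the increment\<close>

definition tower :: "nat \<Rightarrow> real \<Rightarrow> real" where
  "tower m = (\<lambda>x. 2 powr x) ^^ m"

lemma tower_0 [simp]: "tower 0 x = x"
  by (simp add: tower_def)

lemma tower_Suc: "tower (Suc m) x = 2 powr tower m x"
  by (simp add: tower_def)

lemma tower_Suc_right: "tower (Suc m) x = tower m (2 powr x)"
  by (simp add: tower_def funpow_Suc_right del: funpow.simps)

lemma tower_mono: "x \<le> y \<Longrightarrow> tower m x \<le> tower m y"
  by (induction m) (auto simp: tower_Suc)

lemma tower_ge: "0 \<le> x \<Longrightarrow> x \<le> tower m x"
proof (induction m)
  case (Suc m)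
  then show ?case using less_two_powr[of "tower m x"] by (simp add: tower_Suc)
qed simp

text \<open>An outer factor can be moved to the top: for \<open>T \<ge> 2\<close> one has
  \<open>a \<le> 2 powr ((a - 1) * T)\<close>, so
  \<open>a * 2 powr T \<le> 2 powr (a * T)\<close>.\<close>

lemma tower_mult:
  assumes "2 \<le> a" "2 \<le> x"
  shows "a * tower m x \<le> tower m (a * x)"
proof (induction m)
  case (Suc m)
  have x: "2 \<le> tower m x" using tower_ge[of x m] assms by simp
  have "a * 1 \<le> (a - 1) * 2" using assms by simp
  also have "\<dots> \<le> (a - 1) * tower m x" using assms x by (intro mult_left_mono) auto
  finally have "a \<le> (a - 1) * tower m x" by simp
  then have "a \<le> 2 powr ((a - 1) * tower m x)"
    using less_two_powr[of "(a - 1) * tower m x"] assms by simp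
  then have "a * tower (Suc m) x \<le> 2 powr ((a - 1) * tower m x) * 2 powr tower m x"
    by (simp add: tower_Suc mult_right_mono)
  also have "\<dots> = 2 powr (a * tower m x)" by (simp add: algebra_simps flip: powr_add)
  also have "\<dots> \<le> tower (Suc m) (a * x)" using Suc.IH by (simp add: tower_Suc)
  finally show ?case .
qed simp

text \<open>Here \<open>m\<close> bounds the number of rounds left. The ratio \<open>c\<close> never
  falls below \<open>c0\<close>, so each round adds at least \<open>c0^4 / 32\<close>; with no
  rounds left it exceeds 1/2, which no nonempty family permits. Each round multiplies
  \<open>d\<close> by an exponential of \<open>d\<close>, costing one level of the tower.\<close>

lemma card_less_tower:
  fixes c c0 d q :: real and V :: "'a set" and I :: "'i::linorder set"
  assumes "0 < c0" "c0 \<le> 1 / 2"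
    and "ordered_induced V I M" "\<And>i. i \<in> I \<Longrightarrow> q \<le> card (M i)"
    and "0 < q" "c0 \<le> c" "c * card V \<le> q" "1/2 < c + m * (c0 ^ 4 / 32)"
    and "1 \<le> d" "card V \<le> d * card I"
  shows "card I < tower m (4 * (408 / c0 ^ 3) * d)"
  using assms(3-)
proof (induction m arbitrary: V I M q c d)
  case (0 V I M q c d)
  have "I = {}"
  proof (rule ccontr)
    assume "I \<noteq> {}"
    then obtain i where i: "i \<in> I" by blast
    have "card (\<Union>(M i)) \<le> card V"
      using card_Union_matching(3)[OF 0(1) i] ordered_inducedD(1)[OF 0(1)] by (rule card_mono[rotated])
    then have "2 * q \<le> card V" using card_Union_matching(2)[OF 0(1) i] 0(2)[OF i] by simp
    moreover from this have "1/2 * card V < c * card V"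
      using 0 by (intro mult_strict_right_mono) auto
    ultimately show False using 0(5) by simp
  qed
  then show ?case using 0 assms(1) by simp
next
  case (Suc m V I M q c d)
  define K where "K = 408 / c0 ^ 3"
  have c0: "c0 ^ 3 \<le> 1" using assms(1,2) by (intro power_le_one) auto
  then have K: "2 \<le> K" using assms(1) by (simp add: K_def field_simps)
  have Kd: "2 \<le> K * d" using mult_mono[of 2 K 1 d] K Suc.prems(7) by simp
  show ?case
  proof (cases "card I < 2")
    case True
    then have "card I < 4 * K * d" using Kd by simp
    also have "\<dots> \<le> tower (Suc m) (4 * K * d)" using Kd by (intro tower_ge) simp
    finally show ?thesis by (simp add: K_def)
  next
    case False
    then have two: "2 \<le> card I" by simp
    have c: "0 < c" using Suc.prems(4) assms(1) by simp
    obtain V' :: "'a set" and I' :: "'i set" and M' and q' :: real where *: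
      "ordered_induced V' I' M'" "\<And>i. i \<in> I' \<Longrightarrow> q' \<le> card (M' i)" "0 < q'"
      "(c + c ^ 4 / 32) * card V' \<le> q'" "card V' \<le> card V"
      "card I \<le> 2 powr (408 * d / c ^ 3) * card I'"
      by (rule density_increment[OF Suc.prems(1,2) c Suc.prems(5,3) two Suc.prems(7,8)], assumption, rule that)
    \<comment> \<open>A bound on the loss of one round that is uniform in \<open>c\<close>; the next
      round runs with \<open>d * p\<close>.\<close>
    define p where "p = 2 powr (K * d)"
    have "2 powr 2 \<le> p" unfolding p_def using Kd by (intro powr_mono) auto
    then have p: "K * d \<le> p" "4 \<le> p" "1 \<le> p"
      using less_two_powr[of "K * d"] Kd by (auto simp: p_def)
    have "408 / c ^ 3 \<le> K" unfolding K_def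
      using Suc.prems(4) assms(1) by (intro divide_left_mono power_mono mult_pos_pos) auto
    then have "408 / c ^ 3 * d \<le> K * d" using Suc.prems(7) by (intro mult_right_mono) auto
    then have "2 powr (408 * d / c ^ 3) \<le> p" by (simp add: p_def)
    then have "2 powr (408 * d / c ^ 3) * card I' \<le> p * card I'" by (intro mult_right_mono) auto
    then have I: "card I \<le> p * card I'" using *(6) by linarith
    have "card I' < tower m (4 * (408 / c0 ^ 3) * (d * p))"
    proof (rule Suc.IH[OF *(1,2,3)])
      have "c0 ^ 4 \<le> c ^ 4" using Suc.prems(4) assms(1) by (intro power_mono) auto
      moreover have "0 < c0 ^ 4" using assms(1) by simp
      moreover have "real (Suc m) * (c0 ^ 4 / 32) = c0 ^ 4 / 32 + m * (c0 ^ 4 / 32)"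
        by (simp add: distrib_right)
      ultimately show "c0 \<le> c + c ^ 4 / 32" "1 / 2 < c + c ^ 4 / 32 + m * (c0 ^ 4 / 32)"
        using Suc.prems(4,6) by linarith+
      show "1 \<le> d * p" using mult_mono[of 1 d 1 p] Suc.prems(7) p(3) by simp
      have "d * real (card I) \<le> d * (p * card I')" using I Suc.prems(7) by (intro mult_left_mono) auto
      then show "card V' \<le> d * p * card I'" using *(5) Suc.prems(8) by (simp add: mult.assoc)
    qed (use * in auto)
    then have "card I' < tower m (4 * K * (d * p))" by (simp add: K_def)
    then have "p * card I' < p * tower m (4 * K * (d * p))" using p(2) by simp
    also have "\<dots> \<le> tower m (p * (4 * K * (d * p)))"
    proof (rule tower_mult)
      show "2 \<le> 4 * K * (d * p)" using mult_mono[of 2 "K * d" 1 p] Kd p(3) by (simp add: mult_ac)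
    qed (use p in simp)
    \<comment> \<open>The factor 4 at the top of the tower is used here: \<open>4 \<le> p\<close>
      and \<open>K * d \<le> p\<close> bound everything by the fourth power of
      \<open>p\<close>.\<close>
    also have "\<dots> \<le> tower m (2 powr (4 * K * d))"
    proof (rule tower_mono)
      have "p * (4 * K * (d * p)) = (4 * (K * d)) * (p * p)" by simp
      also have "\<dots> \<le> (p * p) * (p * p)"
        using p Kd by (intro mult_right_mono mult_mono) auto
      also have "\<dots> = 2 powr (4 * K * d)" by (simp add: p_def mult.assoc flip: powr_add)
      finally show "p * (4 * K * (d * p)) \<le> 2 powr (4 * K * d)" .
    qed
    finally show ?thesis using I by (simp add: tower_Suc_right K_def)
  qed
qed

section \<open>Iterated logarithms as eventual inverses of towers\<close>

lemma iter_log_at_top: "filterlim (iter_log m) at_top at_top"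
proof (induction m)
  case 0
  then show ?case by (simp add: iter_log_def filterlim_ident)
next
  case (Suc m)
  have "filterlim (\<lambda>x. log 2 (iter_log m x)) at_top at_top"
    by (rule filterlim_compose[OF _ Suc]) real_asymp
  then show ?case by (simp add: iter_log_def)
qed

lemma tower_iter_log: "\<forall>\<^sub>F x in at_top. tower m (iter_log m x) = x"
proof (induction m)
  case 0
  then show ?case by (simp add: iter_log_def)
next
  case (Suc m)
  have "\<forall>\<^sub>F x in at_top. 0 < iter_log m x"
    using iter_log_at_top by (rule filterlim_at_top_dense[THEN iffD1, rule_format])
  with Suc show ?case
    by eventually_elim (simp add: tower_Suc_right iter_log_def)
qed

section \<open>Transfer to \<open>ORS\<close> and the asymptotic bound\<close>

lemma is_matchingD:
  assumes "is_matching n M"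
  shows "\<And>e. e \<in> M \<Longrightarrow> e \<subseteq> {..<n}" "\<And>e. e \<in> M \<Longrightarrow> card e = 2" "pairwise disjnt M"
  using assms unfolding is_matching_def by (auto 0 4 simp: pairwise_def disjnt_def)

lemma ORS_graph_ordered_induced:
  assumes "ORS_graph n r t"
  obtains M where "ordered_induced {..<n} {..<t} M" "\<And>i. i < t \<Longrightarrow> card (M i) = r"
proof -
  obtain M where M: "\<forall>i<t. is_matching n (M i) \<and> card (M i) = r"
    "\<forall>i<t. \<forall>j<i. \<forall>e\<in>M j. \<not> e \<subseteq> matched_vertices (M i)"
    using assms unfolding ORS_graph_def by blast
  have "ordered_induced {..<n} {..<t} M"
    unfolding ordered_induced_def
  proof (intro conjI ballI impI)
    fix i assume "i \<in> {..<t}"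
    then have i: "is_matching n (M i)" using M(1) by simp
    show "e \<subseteq> {..<n}" "card e = 2" if "e \<in> M i" for e
      using is_matchingD(1,2)[OF i that] .
    show "pairwise disjnt (M i)" by (rule is_matchingD(3)[OF i])
  qed (use M(2) in \<open>auto simp: matched_vertices_def\<close>)
  with M(1) show ?thesis using that by blast
qed

text \<open>A crude count of edges that makes the supremum in \<open>ORS\<close> finite. For
  \<open>r = 0\<close> empty matchings allow every \<open>t\<close>, hence
  \<open>0 < r\<close>.\<close>

lemma ORS_graph_le:
  assumes "ORS_graph n r t" "0 < r"
  shows "t \<le> n\<^sup>2"
proof -
  obtain M where M: "ordered_induced {..<n} {..<t} M" "\<And>i. i < t \<Longrightarrow> card (M i) = r"
    using ORS_graph_ordered_induced[OF assms(1)] by blast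
  have "t \<le> (\<Sum>j<t. 2 * card (M j))"
    using M(2) assms(2) sum_mono[of "{..<t}" "\<lambda>_. 1" "\<lambda>j. 2 * card (M j)"] by simp
  also have "\<dots> = (\<Sum>v<n. card (nbrs M {..<t} v))"
    using sum_card_nbrs[OF M(1)] by simp
  also have "\<dots> \<le> (\<Sum>v<n. n)"
  proof (rule sum_mono)
    fix v
    have "nbrs M {..<t} v \<subseteq> {..<n}" using ordered_inducedD(3)[OF M(1)] by (auto simp: nbrs_def)
    then show "card (nbrs M {..<t} v) \<le> n" using card_mono[of "{..<n}"] by fastforce
  qed
  finally show ?thesis by (simp add: power2_eq_square)
qed

text \<open>A nonempty bounded set of naturals contains its supremum, so an extremal family exists
  to which the tower bound applies.\<close>

lemma ORS_graph_ORS: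
  assumes "0 < r"
  shows "ORS_graph n r (ORS n r)"
proof -
  have "{t. ORS_graph n r t} \<noteq> {}"
  proof -
    have "ORS_graph n r 0" by (simp add: ORS_graph_def)
    then show ?thesis by blast
  qed
  moreover have "bdd_above {t. ORS_graph n r t}"
    using ORS_graph_le assms by (intro bdd_aboveI) blast
  ultimately show ?thesis
    unfolding ORS_def using Max_in[of "{t. ORS_graph n r t}"] by (simp add: Sup_nat_def bdd_above_nat)
qed

theorem theorem1p2:
  shows "\<exists>(A::real) (k::nat). A > 0 \<and>
    (\<forall>c::real. 0 < c \<and> c \<le> 1/2 \<longrightarrow>
      (\<exists>l::nat. 1 \<le> l \<and> real l \<le> A * (1/c) ^ k \<and>
        (\<exists>C::real. C > 0 \<and>
          (\<forall>\<^sub>F n in sequentially.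
             real (ORS_real n (c * real n)) \<le> C * real n / iter_log l (real n)))))"
proof (rule exI[of _ 18], rule exI[of _ 4], intro conjI allI impI)
  fix c :: real
  assume c: "0 < c \<and> c \<le> 1/2"
  \<comment> \<open>With \<open>m\<close> at least \<open>16 / c^4\<close>, that many increments of
    \<open>c^4 / 32\<close> add at least 1/2. The exponent \<open>l\<close> will be
    \<open>Suc m\<close>, at most \<open>16 / c^4 + 2\<close>.\<close>
  define m where "m = nat \<lceil>16 / c ^ 4\<rceil>"
  define C where "C = 4 * (408 / c ^ 3)"
  have C: "0 < C" using c by (simp add: C_def)
  have m: "16 / c ^ 4 \<le> m" "m \<le> 16 / c ^ 4 + 1" using c by (auto simp: m_def)
  have "c ^ 4 \<le> 1" using c by (intro power_le_one) auto
  then have l: "real (Suc m) \<le> 18 * (1 / c) ^ 4"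
    using m(2) c by (simp add: field_simps)
  have dens: "1/2 < c + m * (c ^ 4 / 32)"
    using m(1) c by (simp add: field_simps)
  have tower: "\<forall>\<^sub>F n in sequentially. tower (Suc m) (iter_log (Suc m) (real n)) = n"
    using tower_iter_log filterlim_real_sequentially by (rule eventually_compose_filterlim)
  have large: "\<forall>\<^sub>F n in sequentially. C \<le> iter_log (Suc m) (real n)"
    using filterlim_compose[OF iter_log_at_top filterlim_real_sequentially]
    by (simp add: filterlim_at_top)
  have "\<forall>\<^sub>F n in sequentially. (log 2 (real n))\<^sup>2 < C * n"
    using C by real_asymp
  with tower large eventually_gt_at_top[of 0]
  have "\<forall>\<^sub>F n in sequentially. real (ORS_real n (c * real n)) \<le> C * real n / iter_log (Suc m) (real n)"
  proof eventually_elim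
    case (elim n)
    define x where "x = iter_log (Suc m) (real n)"
    \<comment> \<open>Then \<open>C * d = x\<close> is the top of the tower in
      \<open>card_less_tower\<close>. Taking one logarithm more than the tower has levels makes that
      tower \<open>log 2 n\<close> rather than \<open>n\<close>.\<close>
    define d where "d = x / C"
    define r where "r = nat \<lceil>c * n\<rceil>"
    define t where "t = ORS n r"
    have "0 < x" using elim(2) C by (simp add: x_def)
    moreover have "log 2 (2 powr tower m x) = log 2 n"
      using elim(1) unfolding x_def tower_Suc by (rule arg_cong)
    then have "tower m x = log 2 n" by simp
    ultimately have x: "0 < x" "tower m x = log 2 n" by simp_all
    have d: "1 \<le> d" "C * d = x" using elim C by (auto simp: d_def x_def)
    have cn: "0 < c * n" using c elim by simp
    then have r: "c * n \<le> r" "0 < r" by (auto simp: r_def)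
    obtain M where M: "ordered_induced {..<n} {..<t} M" "\<And>i. i < t \<Longrightarrow> card (M i) = r"
      using ORS_graph_ordered_induced ORS_graph_ORS[OF r(2)] unfolding t_def by metis
    have "t \<le> n / d"
    \<comment> \<open>Otherwise \<open>t < log 2 n\<close>, and also \<open>x \<le> log 2 n\<close>,
      so \<open>C * n < x * t\<close> would be at most the square of \<open>log 2 n\<close>, which
      is too small for large \<open>n\<close>.\<close>
    proof (rule ccontr)
      assume "\<not> t \<le> n / d"
      then have nt: "n < d * t" using d by (simp add: field_simps)
      have "card {..<t} < tower m (4 * (408 / c ^ 3) * d)"
        by (rule card_less_tower[OF _ _ M(1), of c "c * n" c])
          (use c cn r M(2) dens d nt in auto)
      then have "t < log 2 n" using d x by (simp add: C_def)
      moreover have "x \<le> log 2 n" using tower_ge[of x m] x by simp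
      ultimately have "x * t \<le> log 2 n * log 2 n" using x by (intro mult_mono) auto
      moreover have "C * n < C * (d * t)" using nt C by simp
      ultimately show False using elim d by (simp add: power2_eq_square flip: mult.assoc)
    qed
    then show ?case using C x by (simp add: ORS_real_def t_def r_def d_def x_def mult.commute)
  qed
  with l C show "\<exists>l::nat. 1 \<le> l \<and> real l \<le> 18 * (1/c) ^ 4 \<and>
      (\<exists>C::real. C > 0 \<and> (\<forall>\<^sub>F n in sequentially.
         real (ORS_real n (c * real n)) \<le> C * real n / iter_log l (real n)))"
    by (intro exI[of _ "Suc m"]) auto
qed simp

end
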